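(* Let $n\ge 3$ be an integer and let $\alpha$ be a real number with $n-2\le\alpha<n$ and $\alpha\ne 1$. Then there exists an origin-symmetric convex body $L$ in $\mathbb{R}^n$ such that $|x|_2^{-\alpha}\|x\|_L$ is not a positive definite distribution on $\mathbb{R}^n$.
   Context: A convex body in $\mathbb{R}^n$ is a compact convex set with non-empty interior. $|x|_2$ is the Euclidean norm on $\mathbb{R}^n$. For an origin-symmetric convex body $L$, $\|x\|_L=\min\{a\ge 0: x\in aL\}$ is its Minkowski functional. The function $|x|_2^{-\alpha}\|x\|_L$ is homogeneous of degree $1-\alpha>-n$, hence locally integrable, and is regarded as a tempered distribution. The Fourier transform of a distribution $f$ is defined by $\langle\hat f,\phi\rangle=\langle f,\hat\phi\rangle$ for every Schwartz function $\phi$, where $\hat\phi(\xi)=\int_{\mathbb{R}^n}\phi(x)e^{-i(x,\xi)}dx$. A distribution $f$ is positive definite if its Fourier transform is a positive distribution, i.e. $\langle\hat f,\phi\rangle\ge 0$ for every non-negative test function $\phi$. *)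

theory Defs
  imports "HOL-Analysis.Analysis"
begin

definition convex_body :: "'a::euclidean_space set \<Rightarrow> bool" where
  "convex_body L \<longleftrightarrow> compact L \<and> convex L \<and> interior L \<noteq> {}"

definition origin_symmetric :: "'a::real_vector set \<Rightarrow> bool" where
  "origin_symmetric L \<longleftrightarrow> uminus ` L = L"

definition minkowski_functional :: "'a::real_vector set \<Rightarrow> 'a \<Rightarrow> real" where
  "minkowski_functional L x = (LEAST a. 0 \<le> a \<and> x \<in> (\<lambda>y. a *\<^sub>R y) ` L)"

definition partial_derivative :: "'n::finite \<Rightarrow> (real^'n \<Rightarrow> complex) \<Rightarrow> real^'n \<Rightarrow> complex" where
  "partial_derivative i \<phi> x = frechet_derivative \<phi> (at x) (axis i 1)"

text \<open>A multi-index is represented by the list of coordinates with respect to which one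
  differentiates successively. The differentiability of all iterated partial derivatives is
  smoothness, and makes every occurrence of \<^const>\<open>frechet_derivative\<close> meaningful.\<close>

definition iterated_partial ::
    "'n::finite list \<Rightarrow> (real^'n \<Rightarrow> complex) \<Rightarrow> real^'n \<Rightarrow> complex" where
  "iterated_partial is \<phi> = foldr partial_derivative is \<phi>"

definition schwartz_function :: "(real^'n::finite \<Rightarrow> complex) \<Rightarrow> bool" where
  "schwartz_function \<phi> \<longleftrightarrow>
     (\<forall>is x. iterated_partial is \<phi> differentiable (at x)) \<and>
     (\<forall>is k::nat. bounded (range (\<lambda>x. norm x ^ k *\<^sub>R iterated_partial is \<phi> x)))"

definition fourier_transform ::
    "('a::euclidean_space \<Rightarrow> complex) \<Rightarrow> 'a \<Rightarrow> complex" where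
  "fourier_transform \<phi> \<xi> =
     (LINT x|lborel. \<phi> x * exp (- (\<i> * complex_of_real (x \<bullet> \<xi>))))"

text \<open>Distributions are represented by their pairing with Schwartz functions; the values of
  such a functional on other functions are irrelevant.\<close>

type_synonym 'n distribution = "(real^'n \<Rightarrow> complex) \<Rightarrow> complex"

definition distribution_of :: "(real^'n::finite \<Rightarrow> real) \<Rightarrow> 'n distribution" where
  "distribution_of f \<phi> = (LINT x|lborel. complex_of_real (f x) * \<phi> x)"

definition distribution_fourier :: "'n::finite distribution \<Rightarrow> 'n distribution" where
  "distribution_fourier T \<phi> = T (fourier_transform \<phi>)"

definition positive_distribution :: "'n::finite distribution \<Rightarrow> bool" where
  "positive_distribution T \<longleftrightarrow>
     (\<forall>\<phi>. schwartz_function \<phi> \<and> (\<forall>x. \<phi> x \<in> \<real>\<^sub>\<ge>\<^sub>0) \<longrightarrow> T \<phi> \<in> \<real>\<^sub>\<ge>\<^sub>0)"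

definition positive_definite_distribution :: "'n::finite distribution \<Rightarrow> bool" where
  "positive_definite_distribution T \<longleftrightarrow> positive_distribution (distribution_fourier T)"

end

theory Submission
  imports Defs "HOL-Probability.Probability" "HOL-Real_Asymp.Real_Asymp"
begin

text \<open>
  Take \<open>\<parallel>x\<parallel> = \<bar>x \<bullet> e\<bar> + \<epsilon> |x|\<close> for a unit coordinate vector \<open>e\<close>. The Fourier transform of the
  Gaussian that has variance \<open>a\<close> in the direction \<open>e\<close> and variance 1 in the orthogonal directions is
  proportional to \<open>\<surd>a exp (- (a (x \<bullet> e)\<^sup>2 + |x'|\<^sup>2) / 2)\<close>. As \<open>a\<close> grows, the Gaussian (normalised to
  have value 1 at the origin) increases, so positive definiteness would force
  \<open>a \<mapsto> \<surd>a \<integral> |x| powr (- \<alpha>) \<parallel>x\<parallel> exp (- (a (x \<bullet> e)\<^sup>2 + |x'|\<^sup>2) / 2)\<close>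
  to be nondecreasing. For \<open>\<epsilon> = 0\<close> this positive quantity tends to 0 by dominated convergence:
  \<open>\<surd>a \<bar>x \<bullet> e\<bar> exp (- a (x \<bullet> e)\<^sup>2 / 2)\<close> is bounded and tends to 0 pointwise. The failure of
  monotonicity between \<open>1\<close> and some large \<open>a\<close> persists for small \<open>\<epsilon> > 0\<close>, which makes the unit ball
  compact.
\<close>

section \<open>Schwartz functions\<close>

lemma iterated_partial_simps [simp]:
  "iterated_partial [] \<phi> = \<phi>"
  "iterated_partial (i # is) \<phi> = partial_derivative i (iterated_partial is \<phi>)"
  by (simp_all add: iterated_partial_def)

text \<open>\<open>frechet_derivative\<close> is defined by choice, so it respects differences only
  at points where both functions are differentiable. The smoothness assumptions provide this at
  every stage of the induction.\<close>

lemma iterated_partial_diff: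
  assumes "\<And>is x. iterated_partial is \<phi> differentiable (at x)"
    and "\<And>is x. iterated_partial is \<psi> differentiable (at x)"
  shows "iterated_partial is (\<lambda>x. \<phi> x - \<psi> x) =
    (\<lambda>x. iterated_partial is \<phi> x - iterated_partial is \<psi> x)"
proof (induction "is")
  case (Cons i "is")
  have "frechet_derivative (\<lambda>x. iterated_partial is \<phi> x - iterated_partial is \<psi> x) (at x) =
      (\<lambda>v. frechet_derivative (iterated_partial is \<phi>) (at x) v -
           frechet_derivative (iterated_partial is \<psi>) (at x) v)" for x
    by (rule sym, rule frechet_derivative_at, intro has_derivative_diff)
       (use assms frechet_derivative_works in blast)+
  then show ?case
    unfolding iterated_partial_simps Cons by (simp add: fun_eq_iff partial_derivative_def)
qed auto

lemma schwartz_function_diff: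
  assumes "schwartz_function \<phi>" "schwartz_function \<psi>"
  shows "schwartz_function (\<lambda>x. \<phi> x - \<psi> x)"
proof -
  have d: "iterated_partial is \<phi> differentiable (at x)" "iterated_partial is \<psi> differentiable (at x)"
    for "is" x
    using assms by (auto simp: schwartz_function_def)
  have b: "bounded (range (\<lambda>x. norm x ^ k *\<^sub>R iterated_partial is \<phi> x))"
    "bounded (range (\<lambda>x. norm x ^ k *\<^sub>R iterated_partial is \<psi> x))" for "is" k
    using assms by (auto simp: schwartz_function_def)
  show ?thesis
    unfolding schwartz_function_def iterated_partial_diff[OF d] scaleR_diff_right
    using d b by (auto intro!: derivative_intros bounded_minus_comp)
qed

text \<open>This keeps the polynomial factor polynomial when a product of a polynomial and an
  exponential is differentiated repeatedly.\<close>

lemma real_polynomial_function_has_derivative: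
  assumes "real_polynomial_function p"
  obtains D where "\<And>x. (p has_derivative D x) (at x)"
    "\<And>v. real_polynomial_function (\<lambda>x. D x v)"
proof -
  have "\<exists>D. (\<forall>x. (p has_derivative D x) (at x)) \<and> (\<forall>v. real_polynomial_function (\<lambda>x. D x v))"
    using assms
  proof induction
    case (linear f)
    then show ?case
      by (intro exI[of _ "\<lambda>x. f"]) (auto intro: bounded_linear_imp_has_derivative)
  next
    case (const c)
    show ?case
      by (intro exI[of _ "\<lambda>x v. 0"]) auto
  next
    case (add f g)
    then obtain D D' where "\<And>x. (f has_derivative D x) (at x)" "\<And>x. (g has_derivative D' x) (at x)"
      "\<And>v. real_polynomial_function (\<lambda>x. D x v)" "\<And>v. real_polynomial_function (\<lambda>x. D' x v)"
      by blast
    then show ?case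
      by (intro exI[of _ "\<lambda>x v. D x v + D' x v"]) (auto intro: has_derivative_add)
  next
    case (mult f g)
    then obtain D D' where "\<And>x. (f has_derivative D x) (at x)" "\<And>x. (g has_derivative D' x) (at x)"
      "\<And>v. real_polynomial_function (\<lambda>x. D x v)" "\<And>v. real_polynomial_function (\<lambda>x. D' x v)"
      by blast
    then show ?case
      using mult.hyps
      by (intro exI[of _ "\<lambda>x v. f x * D' x v + D x v * g x"] conjI allI has_derivative_mult
          real_polynomial_function.intros(3,4)) auto
  qed
  with that show thesis by blast
qed

lemma real_polynomial_function_growth:
  assumes "real_polynomial_function p"
  obtains C m where "\<And>x. \<bar>p x\<bar> \<le> C * (1 + norm x) ^ m"
proof -
  have "\<exists>C m. \<forall>x. \<bar>p x\<bar> \<le> C * (1 + norm x) ^ m"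
    using assms
  proof induction
    case (linear f)
    then obtain K where K: "\<And>x. norm (f x) \<le> norm x * K" "K > 0"
      using bounded_linear.pos_bounded by blast
    show ?case
    proof (intro exI allI)
      show "\<bar>f x\<bar> \<le> K * (1 + norm x) ^ 1" for x
        using K(1)[of x] K(2) by (simp add: algebra_simps)
    qed
  next
    case (const c)
    show ?case
      by (intro exI[of _ "\<bar>c\<bar>"] exI[of _ 0]) auto
  next
    case (add f g)
    then obtain C m C' m' where *: "\<And>x. \<bar>f x\<bar> \<le> C * (1 + norm x) ^ m"
      "\<And>x. \<bar>g x\<bar> \<le> C' * (1 + norm x) ^ m'"
      by blast
    \<comment> \<open>Absolute values make both coefficients nonnegative, so that the powers can be
      raised to the common exponent \<open>m + m'\<close>.\<close>
    have "\<bar>f x + g x\<bar> \<le> (\<bar>C\<bar> + \<bar>C'\<bar>) * (1 + norm x) ^ (m + m')" for x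
    proof -
      have "\<bar>f x + g x\<bar> \<le> \<bar>C\<bar> * (1 + norm x) ^ m + \<bar>C'\<bar> * (1 + norm x) ^ m'"
        using *[of x] mult_right_mono[of C "\<bar>C\<bar>" "(1 + norm x) ^ m"]
          mult_right_mono[of C' "\<bar>C'\<bar>" "(1 + norm x) ^ m'"]
        by (smt (verit) abs_ge_self norm_ge_zero zero_le_power)
      also have "\<dots> \<le> \<bar>C\<bar> * (1 + norm x) ^ (m + m') + \<bar>C'\<bar> * (1 + norm x) ^ (m + m')"
        by (intro add_mono mult_left_mono power_increasing) auto
      finally show ?thesis by (simp add: algebra_simps)
    qed
    then show ?case by blast
  next
    case (mult f g)
    then obtain C m C' m' where *: "\<And>x. \<bar>f x\<bar> \<le> C * (1 + norm x) ^ m"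
      "\<And>x. \<bar>g x\<bar> \<le> C' * (1 + norm x) ^ m'"
      by blast
    have "\<bar>f x * g x\<bar> \<le> (C * C') * (1 + norm x) ^ (m + m')" for x
      using mult_mono'[OF *(1)[of x] *(2)[of x]] by (simp add: abs_mult power_add mult_ac)
    then show ?case by blast
  qed
  with that show thesis by blast
qed

text \<open>Up to the factor \<open>fact m\<close>, the power is one term of the exponential series
  at \<open>1 + r\<close>. Completing the square then bounds \<open>1 + r - c * r^2\<close> by its
  maximum \<open>1 + 1 / (4 * c)\<close>.\<close>

lemma power_mult_exp_neg_square_bounded:
  fixes c r :: real
  assumes "c > 0" "r \<ge> 0"
  shows "(1 + r) ^ m * exp (- (c * r\<^sup>2)) \<le> fact m * exp (1 + 1 / (4 * c))"
proof -
  have "(1 + r) ^ m / fact m \<le> (\<Sum>n\<le>m. (1 + r) ^ n / fact n)"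
    using assms by (intro member_le_sum) auto
  also have "\<dots> \<le> exp (1 + r)"
    using assms summable_exp_generic[of "1 + r"]
    by (auto simp: exp_def divide_inverse scaleR_conv_of_real mult.commute intro!: sum_le_suminf)
  finally have "(1 + r) ^ m \<le> fact m * exp (1 + r)"
    by (simp add: field_simps)
  then have "(1 + r) ^ m * exp (- (c * r\<^sup>2)) \<le> fact m * exp (1 + r) * exp (- (c * r\<^sup>2))"
    by (rule mult_right_mono) simp
  also have "\<dots> = fact m * exp (1 + r - c * r\<^sup>2)"
    by (simp add: exp_diff exp_minus field_simps)
  also have "1 + r - c * r\<^sup>2 = 1 + 1 / (4 * c) - c * (r - 1 / (2 * c))\<^sup>2"
    using assms by (simp add: field_simps power2_eq_square)
  also have "exp \<dots> \<le> exp (1 + 1 / (4 * c))"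
    using assms by simp
  finally show ?thesis by simp
qed

text \<open>For fixed \<open>q\<close>, the functions \<open>r * exp (- q)\<close> with
  \<open>r\<close> polynomial are closed under partial differentiation: \<open>r\<close> is replaced
  by \<open>r' - r * q'\<close>, again a polynomial. Hence every iterated partial derivative has
  this form, and coercivity of \<open>q\<close> beats the polynomial growth.\<close>

lemma schwartz_function_polynomial_times_exp:
  fixes p q :: "real^'n \<Rightarrow> real"
  assumes p: "real_polynomial_function p" and q: "real_polynomial_function q"
    and "c > 0" and coercive: "\<And>x. c * (norm x)\<^sup>2 \<le> q x"
  shows "schwartz_function (\<lambda>x. complex_of_real (p x * exp (- q x)))"
proof -
  obtain Dq where Dq: "\<And>x. (q has_derivative Dq x) (at x)"
    "\<And>v. real_polynomial_function (\<lambda>x. Dq x v)"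
    using real_polynomial_function_has_derivative[OF q] by blast
  have deriv: "\<exists>D. (\<forall>x. ((\<lambda>x. complex_of_real (r x * exp (- q x))) has_derivative
        (\<lambda>v. complex_of_real (D x v * exp (- q x)))) (at x)) \<and>
      (\<forall>v. real_polynomial_function (\<lambda>x. D x v))" if r: "real_polynomial_function r" for r
  proof -
    obtain Dr where Dr: "\<And>x. (r has_derivative Dr x) (at x)"
      "\<And>v. real_polynomial_function (\<lambda>x. Dr x v)"
      using real_polynomial_function_has_derivative[OF r] by blast
    \<comment> \<open>The difference is written with a factor \<open>- 1\<close> because
      \<open>real_polynomial_function\<close> is generated by linear maps, constants, sums and
      products.\<close>
    have "((\<lambda>x. complex_of_real (r x * exp (- q x))) has_derivative
        (\<lambda>v. complex_of_real ((Dr x v + (- 1) * (r x * Dq x v)) * exp (- q x)))) (at x)" for x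
      by (rule has_derivative_eq_rhs, rule has_derivative_of_real, rule has_derivative_mult,
          rule Dr, rule DERIV_exp[THEN DERIV_compose_FDERIV], rule has_derivative_minus, rule Dq)
         (auto simp: fun_eq_iff algebra_simps)
    moreover have "real_polynomial_function (\<lambda>x. Dr x v + (- 1) * (r x * Dq x v))" for v
      using Dr Dq r by (intro real_polynomial_function.intros(2-4))
    ultimately show ?thesis
      by (intro exI[of _ "\<lambda>x v. Dr x v + (- 1) * (r x * Dq x v)"]) blast
  qed
  have iterated: "\<exists>r. real_polynomial_function r \<and>
      iterated_partial is (\<lambda>x. complex_of_real (p x * exp (- q x))) =
      (\<lambda>x. complex_of_real (r x * exp (- q x)))" for "is"
  proof (induction "is")
    case Nil
    then show ?case using p by auto
  next
    case (Cons i "is")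
    then obtain r where r: "real_polynomial_function r"
      "iterated_partial is (\<lambda>x. complex_of_real (p x * exp (- q x))) =
        (\<lambda>x. complex_of_real (r x * exp (- q x)))"
      by blast
    obtain D where D: "\<And>x. ((\<lambda>x. complex_of_real (r x * exp (- q x))) has_derivative
        (\<lambda>v. complex_of_real (D x v * exp (- q x)))) (at x)"
      "\<And>v. real_polynomial_function (\<lambda>x. D x v)"
      using deriv[OF r(1)] by blast
    have "iterated_partial (i # is) (\<lambda>x. complex_of_real (p x * exp (- q x))) =
        (\<lambda>x. complex_of_real (D x (axis i 1) * exp (- q x)))"
      unfolding iterated_partial_simps r(2) partial_derivative_def
        frechet_derivative_at[OF D(1), symmetric] by simp
    then show ?case using D(2) by blast
  qed
  show ?thesis
    unfolding schwartz_function_def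
  proof (intro conjI allI)
    fix "is" :: "'n list" and x
    obtain r where r: "real_polynomial_function r"
      "iterated_partial is (\<lambda>x. complex_of_real (p x * exp (- q x))) =
        (\<lambda>x. complex_of_real (r x * exp (- q x)))"
      using iterated by blast
    show "iterated_partial is (\<lambda>x. complex_of_real (p x * exp (- q x))) differentiable (at x)"
      unfolding r(2) using deriv[OF r(1)] differentiable_def by blast
  next
    fix "is" :: "'n list" and k :: nat
    obtain r where r: "real_polynomial_function r"
      "iterated_partial is (\<lambda>x. complex_of_real (p x * exp (- q x))) =
        (\<lambda>x. complex_of_real (r x * exp (- q x)))"
      using iterated by blast
    obtain C m where C: "\<And>x. \<bar>r x\<bar> \<le> C * (1 + norm x) ^ m"
      using real_polynomial_function_growth[OF r(1)] by blast
    have "C \<ge> 0"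
      using C[of 0] by simp
    have "norm (norm x ^ k *\<^sub>R complex_of_real (r x * exp (- q x))) \<le>
        C * (fact (k + m) * exp (1 + 1 / (4 * c)))" for x
    proof -
      have "norm (norm x ^ k *\<^sub>R complex_of_real (r x * exp (- q x))) =
          norm x ^ k * \<bar>r x\<bar> * exp (- q x)"
        by (simp add: norm_mult)
      also have "\<dots> \<le> (1 + norm x) ^ k * (C * (1 + norm x) ^ m) * exp (- (c * (norm x)\<^sup>2))"
        using C[of x] coercive[of x] \<open>C \<ge> 0\<close>
        by (intro mult_mono power_mono) auto
      also have "\<dots> = C * ((1 + norm x) ^ (k + m) * exp (- (c * (norm x)\<^sup>2)))"
        by (simp add: power_add mult_ac)
      also have "\<dots> \<le> C * (fact (k + m) * exp (1 + 1 / (4 * c)))"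
        using \<open>C \<ge> 0\<close> \<open>c > 0\<close>
        by (intro mult_left_mono power_mult_exp_neg_square_bounded) auto
      finally show ?thesis .
    qed
    then show "bounded (range (\<lambda>x. norm x ^ k *\<^sub>R
        iterated_partial is (\<lambda>x. complex_of_real (p x * exp (- q x))) x))"
      unfolding r(2) bounded_iff by blast
  qed
qed

section \<open>Gaussians\<close>

text \<open>For a unit vector \<open>e\<close>, the parameter \<open>s\<close> is the excess of the
  inverse variance along \<open>e\<close> over the value 1 in the orthogonal directions. Variance
  \<open>a\<close> along \<open>e\<close> is thus \<open>s = 1 / a - 1\<close>, and its Fourier
  transform has \<open>s = a - 1\<close>.\<close>

definition gaussian :: "'a::euclidean_space \<Rightarrow> real \<Rightarrow> 'a \<Rightarrow> real" where
  "gaussian e s x = exp (- ((norm x)\<^sup>2 + s * (x \<bullet> e)\<^sup>2) / 2)"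

lemma gaussian_pos: "gaussian e s x > 0"
  by (simp add: gaussian_def)

lemma gaussian_antimono: "s \<le> t \<Longrightarrow> gaussian e t x \<le> gaussian e s x"
  by (simp add: gaussian_def mult_right_mono)

lemma borel_measurable_gaussian [measurable]: "gaussian e s \<in> borel_measurable borel"
  unfolding gaussian_def[abs_def] by measurable

text \<open>A coordinate vector \<open>e\<close> makes the quadratic form diagonal, which reduces
  Fourier transforms to one dimension.\<close>

lemma gaussian_eq_prod:
  assumes "e \<in> Basis"
  shows "gaussian e s x =
    (\<Prod>b\<in>Basis. exp (- (if b = e then 1 + s else 1) * (x \<bullet> b)\<^sup>2 / 2))"
proof -
  have "(norm x)\<^sup>2 + s * (x \<bullet> e)\<^sup>2 = (\<Sum>b\<in>Basis. (x \<bullet> b)\<^sup>2 + (if b = e then s * (x \<bullet> b)\<^sup>2 else 0))"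
    using assms by (simp add: sum.distrib norm_eq_sqrt_inner euclidean_inner[of x x] power2_eq_square sum_nonneg)
  also have "\<dots> = (\<Sum>b\<in>Basis. (if b = e then 1 + s else 1) * (x \<bullet> b)\<^sup>2)"
    by (intro sum.cong) (auto simp: algebra_simps)
  finally show ?thesis
    by (simp add: gaussian_def exp_sum[symmetric] sum_negf sum_divide_distrib)
qed

lemma schwartz_function_gaussian:
  fixes e :: "real^'n"
  assumes "e \<in> Basis" "s > - 1"
  shows "schwartz_function (\<lambda>x. complex_of_real (gaussian e s x))"
proof -
  \<comment> \<open>The squares are spelled out as products of linear forms so that the introduction
    rules for polynomials apply.\<close>
  let ?q = "\<lambda>x. (\<Sum>i\<in>UNIV. (1/2) * ((x \<bullet> axis i 1) * (x \<bullet> axis i 1))) + (s / 2) * ((x \<bullet> e) * (x \<bullet> e))"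
  have lin: "real_polynomial_function (\<lambda>x::real^'n. x \<bullet> v)" for v
    by (intro real_polynomial_function.intros(1) bounded_linear_inner_left)
  have q: "real_polynomial_function ?q"
    by (intro real_polynomial_function.intros(2-4) real_polynomial_function_sum lin) auto
  have norm: "?q x = ((norm x)\<^sup>2 + s * (x \<bullet> e)\<^sup>2) / 2" for x
    by (simp add: norm_vec_def L2_set_def sum_nonneg inner_axis sum_divide_distrib
        add_divide_distrib power2_eq_square real_sqrt_pow2)
  \<comment> \<open>The eigenvalues of the form are 1 and \<open>1 + s\<close>; half of the smaller
    one is the coercivity constant, positive because \<open>s > - 1\<close>.\<close>
  have "min 1 (1 + s) / 2 * (norm x)\<^sup>2 \<le> ?q x" for x
  proof -
    have "(x \<bullet> e)\<^sup>2 \<le> (norm x)\<^sup>2"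
      using Basis_le_norm[OF assms(1), of x] by (simp add: abs_le_square_iff[symmetric])
    then have "min 0 s * (norm x)\<^sup>2 \<le> s * (x \<bullet> e)\<^sup>2"
      using mult_left_mono_neg[of "(x \<bullet> e)\<^sup>2" "(norm x)\<^sup>2" s] by (cases "s \<ge> 0") auto
    moreover have "min 1 (1 + s) = 1 + min 0 s"
      by (simp add: min_def)
    ultimately show ?thesis
      unfolding norm by (simp add: algebra_simps)
  qed
  then have "schwartz_function (\<lambda>x. complex_of_real (1 * exp (- ?q x)))"
    using assms(2) q
    by (intro schwartz_function_polynomial_times_exp[where c = "min 1 (1 + s) / 2"]) auto
  then show ?thesis
    unfolding norm by (simp only: gaussian_def minus_divide_left mult_1)
qed

text \<open>Rescaling by \<open>sqrt a\<close> turns the integral into the characteristic function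
  of the standard normal distribution.\<close>

lemma
  fixes a \<xi> :: real
  assumes "a > 0"
  shows integrable_gaussian_times_iexp:
      "integrable lborel (\<lambda>x. complex_of_real (exp (- x\<^sup>2 / (2 * a))) * exp (- (\<i> * complex_of_real (x * \<xi>))))"
        (is "integrable _ ?f")
    and integral_gaussian_times_iexp:
      "(LINT x|lborel. complex_of_real (exp (- x\<^sup>2 / (2 * a))) * exp (- (\<i> * complex_of_real (x * \<xi>)))) =
        complex_of_real (sqrt (2 * pi) * sqrt a * exp (- a * \<xi>\<^sup>2 / 2))"
proof -
  let ?g = "\<lambda>x. std_normal_density x *\<^sub>R iexp (- (sqrt a * \<xi>) * x)"
  \<comment> \<open>The moment of order 0 is the density itself, which dominates \<open>?g\<close>
    because the character has modulus 1.\<close>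
  have "integrable lborel (\<lambda>x. std_normal_density x * x ^ 0)"
    by (rule integrable_std_normal_moment)
  then have int: "integrable lborel ?g"
    by (rule Bochner_Integration.integrable_bound) (auto simp: norm_mult)
  have eq: "?f (0 + sqrt a * x) = complex_of_real (sqrt (2 * pi)) * ?g x" for x
    using assms by (simp add: std_normal_density_def power_mult_distrib scaleR_conv_of_real mult_ac)
  have "integrable lborel (\<lambda>x. ?f (0 + sqrt a * x))"
    unfolding eq using int by (rule integrable_mult_right)
  then show "integrable lborel ?f"
    using lborel_integrable_real_affine_iff[of "sqrt a" ?f 0] assms by simp
  have "(LINT x|lborel. ?g x) = char std_normal_distribution (- (sqrt a * \<xi>))"
    unfolding char_def by (subst integral_density) auto
  also have "\<dots> = complex_of_real (exp (- a * \<xi>\<^sup>2 / 2))"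
    using assms by (simp add: char_std_normal_distribution power_mult_distrib)
  finally have g: "(LINT x|lborel. ?g x) = complex_of_real (exp (- a * \<xi>\<^sup>2 / 2))" .
  show "(LINT x|lborel. ?f x) = complex_of_real (sqrt (2 * pi) * sqrt a * exp (- a * \<xi>\<^sup>2 / 2))"
    using assms
    by (subst lborel_integral_real_affine[of "sqrt a" _ 0], simp,
        unfold eq Bochner_Integration.integral_mult_right[OF int] g) (simp add: scaleR_conv_of_real mult_ac)
qed

text \<open>Lebesgue measure is the image of the product of the one-dimensional measures under the
  coordinate map, so this is Fubini for separated variables.\<close>

lemma
  fixes f :: "'a::euclidean_space \<Rightarrow> real \<Rightarrow> 'b::{real_normed_field,banach,second_countable_topology}"
  assumes int: "\<And>b. b \<in> Basis \<Longrightarrow> integrable lborel (f b)"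
  shows integrable_lborel_prod: "integrable lborel (\<lambda>x. \<Prod>b\<in>Basis. f b (x \<bullet> b))"
    and integral_lborel_prod:
      "(LINT x|lborel. (\<Prod>b\<in>Basis. f b (x \<bullet> b))) = (\<Prod>b\<in>Basis. LINT t|lborel. f b t)"
proof -
  interpret product_sigma_finite "\<lambda>_::'a. lborel :: real measure"
    by standard
  have [measurable]: "f b \<in> borel_measurable borel" if "b \<in> Basis" for b
    using borel_measurable_integrable[OF int[OF that]] by simp
  show "integrable lborel (\<lambda>x. \<Prod>b\<in>Basis. f b (x \<bullet> b))"
    by (subst lborel_eq, subst integrable_distr_eq) (simp_all add: product_integrable_prod int)
  show "(LINT x|lborel. (\<Prod>b\<in>Basis. f b (x \<bullet> b))) = (\<Prod>b\<in>Basis. LINT t|lborel. f b t)"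
    by (subst lborel_eq, subst integral_distr) (simp_all add: product_integral_prod int)
qed

lemma
  fixes e :: "'a::euclidean_space"
  assumes "e \<in> Basis" "a > 0"
  shows integrable_fourier_gaussian: "integrable lborel
      (\<lambda>x. complex_of_real (gaussian e (1 / a - 1) x) * exp (- (\<i> * complex_of_real (x \<bullet> \<xi>))))"
    and fourier_transform_gaussian:
      "fourier_transform (\<lambda>x. complex_of_real (gaussian e (1 / a - 1) x)) \<xi> =
    complex_of_real (sqrt (2 * pi) ^ DIM('a) * sqrt a * gaussian e (a - 1) \<xi>)"
proof -
  \<comment> \<open>\<open>A b\<close> is the variance in direction \<open>b\<close>. The product of
    the \<open>sqrt (A b)\<close> therefore contributes the single factor
    \<open>sqrt a\<close>.\<close>
  define A where "A b = (if b = e then a else 1)" for b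
  have A: "A b > 0" for b
    using assms by (simp add: A_def)
  let ?f = "\<lambda>b t. complex_of_real (exp (- t\<^sup>2 / (2 * A b))) * exp (- (\<i> * complex_of_real (t * (\<xi> \<bullet> b))))"
  have g1: "gaussian e (1 / a - 1) x = (\<Prod>b\<in>Basis. exp (- (x \<bullet> b)\<^sup>2 / (2 * A b)))" for x
    unfolding gaussian_eq_prod[OF assms(1)]
    by (intro prod.cong) (auto simp: A_def)
  have g2: "gaussian e (a - 1) x = (\<Prod>b\<in>Basis. exp (- A b * (x \<bullet> b)\<^sup>2 / 2))" for x
    unfolding gaussian_eq_prod[OF assms(1)]
    by (intro prod.cong) (auto simp: A_def)
  have e: "exp (- (\<i> * complex_of_real (x \<bullet> \<xi>))) =
      (\<Prod>b\<in>Basis. exp (- (\<i> * complex_of_real ((x \<bullet> b) * (\<xi> \<bullet> b)))))" for x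
    by (simp add: euclidean_inner[of x \<xi>] exp_sum[symmetric] sum_negf sum_distrib_left)
  have eq: "complex_of_real (gaussian e (1 / a - 1) x) * exp (- (\<i> * complex_of_real (x \<bullet> \<xi>))) =
      (\<Prod>b\<in>Basis. ?f b (x \<bullet> b))" for x
    by (simp only: g1 e of_real_prod prod.distrib)
  show "integrable lborel
      (\<lambda>x. complex_of_real (gaussian e (1 / a - 1) x) * exp (- (\<i> * complex_of_real (x \<bullet> \<xi>))))"
    unfolding eq by (intro integrable_lborel_prod integrable_gaussian_times_iexp A)
  have "fourier_transform (\<lambda>x. complex_of_real (gaussian e (1 / a - 1) x)) \<xi> =
      (LINT x|lborel. (\<Prod>b\<in>Basis. ?f b (x \<bullet> b)))"
    unfolding fourier_transform_def eq ..
  also have "\<dots> = (\<Prod>b\<in>Basis. LINT t|lborel. ?f b t)"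
    by (intro integral_lborel_prod integrable_gaussian_times_iexp A)
  also have "\<dots> = (\<Prod>b\<in>Basis. complex_of_real (sqrt (2 * pi) * sqrt (A b) * exp (- A b * (\<xi> \<bullet> b)\<^sup>2 / 2)))"
    by (intro prod.cong refl integral_gaussian_times_iexp A)
  also have "\<dots> = complex_of_real (sqrt (2 * pi) ^ DIM('a) * (\<Prod>b\<in>Basis. sqrt (A b)) * gaussian e (a - 1) \<xi>)"
    by (simp add: g2 prod.distrib)
  also have "(\<Prod>b\<in>Basis. sqrt (A b)) = sqrt a"
    using assms(1) by (simp add: A_def if_distrib[of sqrt] cong: if_cong)
  finally show "fourier_transform (\<lambda>x. complex_of_real (gaussian e (1 / a - 1) x)) \<xi> =
    complex_of_real (sqrt (2 * pi) ^ DIM('a) * sqrt a * gaussian e (a - 1) \<xi>)" .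
qed

section \<open>Integrability of singular weights\<close>

text \<open>On [-1, 1] the Gaussian is at most 1 and the power is integrable because \<gamma> < 1;
  outside, the power is at most 1 and the Gaussian is integrable.\<close>

lemma nn_integral_powr_gaussian_finite:
  fixes \<gamma> c :: real
  assumes "0 \<le> \<gamma>" "\<gamma> < 1" "c > 0"
  shows "(\<integral>\<^sup>+t. ennreal (\<bar>t\<bar> powr (- \<gamma>) * exp (- (c * t\<^sup>2))) \<partial>lborel) < \<infinity>"
proof -
  let ?p = "\<lambda>t::real. ennreal (indicator {0..1} t * t powr (- \<gamma>))"
  let ?e = "\<lambda>t::real. ennreal (exp (- (c * t\<^sup>2)))"
  have "((\<lambda>t. t powr (- \<gamma>)) has_integral (1 powr (- \<gamma> + 1) / (- \<gamma> + 1))) {0..1}"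
    using assms by (intro has_integral_powr_from_0) auto
  from nn_integral_has_integral_lebesgue[OF _ this]
  have p: "(\<integral>\<^sup>+t. ?p t \<partial>lborel) < \<infinity>"
    by simp
  have p': "(\<integral>\<^sup>+t. ?p (- t) \<partial>lborel) < \<infinity>"
    using p nn_integral_real_affine[of ?p "- 1" 0] by simp
  \<comment> \<open>Frequency 0 and variance \<open>1 / (2 * c)\<close> turn the integrand into
    \<open>exp (- (c * t^2))\<close>.\<close>
  have "integrable lborel (\<lambda>t. complex_of_real (exp (- t\<^sup>2 / (2 * (1 / (2 * c))))) *
      exp (- (\<i> * complex_of_real (t * 0))))"
    using assms by (intro integrable_gaussian_times_iexp) auto
  then have e: "(\<integral>\<^sup>+t. ?e t \<partial>lborel) < \<infinity>"
    using assms by (simp add: integrable_iff_bounded mult.commute)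
  have "ennreal (\<bar>t\<bar> powr (- \<gamma>) * exp (- (c * t\<^sup>2))) \<le> ?p t + ?p (- t) + ?e t" for t
  proof -
    have "\<bar>t\<bar> powr (- \<gamma>) * exp (- (c * t\<^sup>2)) \<le> indicator {0..1} t * t powr (- \<gamma>) +
        indicator {0..1} (- t) * (- t) powr (- \<gamma>) + exp (- (c * t\<^sup>2))"
    proof (cases "\<bar>t\<bar> \<le> 1")
      case True
      have "\<bar>t\<bar> powr (- \<gamma>) * exp (- (c * t\<^sup>2)) \<le> \<bar>t\<bar> powr (- \<gamma>)"
        using assms by (intro mult_left_le) auto
      then show ?thesis
        using True by (cases "t \<ge> 0") (auto simp: abs_if indicator_def intro: add_increasing2)
    next
      case False
      then have "\<bar>t\<bar> powr (- \<gamma>) \<le> 1"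
        using assms powr_mono[of "- \<gamma>" 0 "\<bar>t\<bar>"] by (auto split: if_splits)
      then have "\<bar>t\<bar> powr (- \<gamma>) * exp (- (c * t\<^sup>2)) \<le> exp (- (c * t\<^sup>2))"
        by (intro mult_left_le_one_le) auto
      then show ?thesis
        by (auto intro: add_increasing)
    qed
    then show ?thesis
      by (simp add: ennreal_plus[symmetric] ennreal_leI del: ennreal_plus)
  qed
  then have "(\<integral>\<^sup>+t. ennreal (\<bar>t\<bar> powr (- \<gamma>) * exp (- (c * t\<^sup>2))) \<partial>lborel) \<le>
      (\<integral>\<^sup>+t. ?p t + ?p (- t) + ?e t \<partial>lborel)"
    by (intro nn_integral_mono) auto
  also have "\<dots> = (\<integral>\<^sup>+t. ?p t \<partial>lborel) + (\<integral>\<^sup>+t. ?p (- t) \<partial>lborel) + (\<integral>\<^sup>+t. ?e t \<partial>lborel)"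
    by (simp add: nn_integral_add)
  also have "\<dots> < \<infinity>"
    using p p' e by simp
  finally show ?thesis .
qed

lemma AE_lborel_inner_nonzero:
  fixes b :: "'a::euclidean_space"
  assumes "b \<in> Basis"
  shows "AE x in lborel. x \<bullet> b \<noteq> 0"
proof -
  have "negligible {x. x \<bullet> b = 0}"
    by (rule negligible_standard_hyperplane[OF assms])
  moreover have "{x. x \<bullet> b = 0} \<in> sets borel"
    by measurable
  ultimately have "{x. x \<bullet> b = 0} \<in> null_sets lborel"
    by (simp add: negligible_iff_null_sets null_sets_completion_iff)
  then show ?thesis
    by (rule AE_I') auto
qed

lemma integrable_norm_powr_gaussian:
  fixes \<alpha> c :: real
  assumes "0 \<le> \<alpha>" "\<alpha> < DIM('a::euclidean_space)" "c > 0"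
  shows "integrable lborel (\<lambda>x::'a. norm x powr (- \<alpha>) * exp (- (c * (norm x)\<^sup>2)))"
proof (rule integrableI_nonneg)
  \<comment> \<open>The exponent is shared equally among the coordinates, so that \<alpha> below the
    dimension becomes \<open>?\<gamma> < 1\<close>.\<close>
  let ?\<gamma> = "\<alpha> / DIM('a)"
  let ?f = "\<lambda>t::real. \<bar>t\<bar> powr (- ?\<gamma>) * exp (- (c * t\<^sup>2))"
  have "AE x in lborel. \<forall>b\<in>Basis. (x::'a) \<bullet> b \<noteq> 0"
    by (intro AE_finite_allI AE_lborel_inner_nonzero) auto
  \<comment> \<open>Each factor of the bound \<open>|x| powr (- \<alpha>) \<le> (\<Prod>b. |x \<bullet> b| powr (- \<alpha> / n))\<close> is locally integrable.
      It fails where some \<open>x \<bullet> b = 0\<close>, since \<open>0 powr _ = 0\<close>.\<close>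
  then have "AE x in lborel. ennreal (norm (x::'a) powr (- \<alpha>) * exp (- (c * (norm x)\<^sup>2))) \<le>
      (\<Prod>b\<in>Basis. ennreal (?f (x \<bullet> b)))"
  proof eventually_elim
    case (elim x)
    have "x \<noteq> 0"
      using elim SOME_Basis by auto
    then have "norm x powr (- \<alpha>) = (\<Prod>b\<in>(Basis::'a set). norm x powr (- ?\<gamma>))"
      by (simp add: powr_realpow[symmetric] powr_powr)
    also have "\<dots> \<le> (\<Prod>b\<in>Basis. \<bar>x \<bullet> b\<bar> powr (- ?\<gamma>))"
      using elim assms Basis_le_norm by (intro prod_mono conjI powr_mono2') auto
    finally have 1: "norm x powr (- \<alpha>) \<le> (\<Prod>b\<in>Basis. \<bar>x \<bullet> b\<bar> powr (- ?\<gamma>))" .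
    have "(norm x)\<^sup>2 = (\<Sum>b\<in>Basis. (x \<bullet> b)\<^sup>2)"
      by (simp add: norm_eq_sqrt_inner euclidean_inner[of x x] power2_eq_square sum_nonneg)
    then have 2: "exp (- (c * (norm x)\<^sup>2)) = (\<Prod>b\<in>Basis. exp (- (c * (x \<bullet> b)\<^sup>2)))"
      by (simp add: exp_sum[symmetric] sum_negf sum_distrib_left)
    have "norm x powr (- \<alpha>) * exp (- (c * (norm x)\<^sup>2)) \<le> (\<Prod>b\<in>Basis. ?f (x \<bullet> b))"
      unfolding prod.distrib 2[symmetric] using 1 by (rule mult_right_mono) simp
    then show ?case
      by (simp add: prod_ennreal ennreal_leI)
  qed
  then have "(\<integral>\<^sup>+x. ennreal (norm (x::'a) powr (- \<alpha>) * exp (- (c * (norm x)\<^sup>2))) \<partial>lborel) \<le>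
      (\<integral>\<^sup>+x. (\<Prod>b\<in>(Basis::'a set). ennreal (?f (x \<bullet> b))) \<partial>lborel)"
    by (rule nn_integral_mono_AE)
  also have "\<dots> = (\<Prod>b\<in>(Basis::'a set). \<integral>\<^sup>+t. ennreal (?f t) \<partial>lborel)"
    by (rule nn_integral_lborel_prod) auto
  also have "\<dots> < \<infinity>"
    using nn_integral_powr_gaussian_finite[of ?\<gamma> c] assms
    by (simp add: power_less_top_ennreal)
  finally show "(\<integral>\<^sup>+x. ennreal (norm (x::'a) powr (- \<alpha>) * exp (- (c * (norm x)\<^sup>2))) \<partial>lborel) < \<infinity>" .
qed auto

section \<open>The concentrating limit\<close>

text \<open>From (u - 1)^2 >= 0 follows u <= 2 * (1 + u^2 / 4), and 1 + y <= exp y finishes. The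
  rate 1/4 spends only half of a standard Gaussian on absorbing a linear factor.\<close>

lemma mult_exp_neg_square_le_2:
  fixes u :: real
  shows "u * exp (- (u\<^sup>2 / 4)) \<le> 2"
proof -
  have "0 \<le> (u - 1)\<^sup>2"
    by simp
  then have "u \<le> 2 * (1 + u\<^sup>2 / 4)"
    by (simp add: power2_diff)
  also have "\<dots> \<le> 2 * exp (u\<^sup>2 / 4)"
    by (intro mult_left_mono exp_ge_add_one_self) simp
  finally show ?thesis
    by (simp add: exp_minus field_simps)
qed

text \<open>Half of the Gaussian absorbs the linear growth of \<open>N\<close>; the other half makes
  the singular weight integrable. The lemma serves both parts of the norm,
  \<open>N x = |x . e|\<close> and \<open>N x = |x|\<close>.\<close>

lemma integrable_norm_powr_times_gaussian:
  fixes e :: "'a::euclidean_space" and \<alpha> :: real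
  assumes "0 \<le> \<alpha>" "\<alpha> < DIM('a)" "s \<ge> 0"
    and [measurable]: "N \<in> borel_measurable borel" and N: "\<And>x. \<bar>N x\<bar> \<le> norm x"
  shows "integrable lborel (\<lambda>x. norm x powr (- \<alpha>) * N x * gaussian e s x)"
proof (rule Bochner_Integration.integrable_bound)
  show "integrable lborel (\<lambda>x::'a. 2 * (norm x powr (- \<alpha>) * exp (- (1/4 * (norm x)\<^sup>2))))"
    by (intro integrable_mult_right integrable_norm_powr_gaussian assms) simp
  show "AE x in lborel. norm (norm x powr (- \<alpha>) * N x * gaussian e s x) \<le>
      norm (2 * (norm x powr (- \<alpha>) * exp (- (1/4 * (norm x)\<^sup>2))))"
  proof (rule AE_I2)
    fix x :: 'a
    have "\<bar>N x\<bar> * gaussian e s x \<le> norm x * gaussian e 0 x"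
      using N[of x] assms gaussian_pos[of e s x, THEN less_imp_le]
      by (intro mult_mono gaussian_antimono) auto
    also have "\<dots> = (norm x * exp (- ((norm x)\<^sup>2 / 4))) * exp (- (1/4 * (norm x)\<^sup>2))"
      by (simp add: gaussian_def mult_exp_exp)
    also have "\<dots> \<le> 2 * exp (- (1/4 * (norm x)\<^sup>2))"
      by (intro mult_right_mono mult_exp_neg_square_le_2) simp
    finally have "norm x powr (- \<alpha>) * (\<bar>N x\<bar> * gaussian e s x) \<le>
        norm x powr (- \<alpha>) * (2 * exp (- (1/4 * (norm x)\<^sup>2)))"
      by (rule mult_left_mono) simp
    then show "norm (norm x powr (- \<alpha>) * N x * gaussian e s x) \<le>
        norm (2 * (norm x powr (- \<alpha>) * exp (- (1/4 * (norm x)\<^sup>2))))"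
      using gaussian_pos[of e s x] by (simp add: abs_mult mult_ac)
  qed
qed measurable

text \<open>This is dominated convergence along \<open>a = m + 2\<close>, for which
  \<open>s = a - 1\<close> is \<open>m + 1\<close>.\<close>

lemma weighted_gaussian_integral_tendsto_0:
  fixes e :: "'a::euclidean_space" and \<alpha> :: real
  assumes "0 \<le> \<alpha>" "\<alpha> < DIM('a)"
  shows "(\<lambda>m. sqrt (real m + 2) *
      (LINT x|lborel. norm x powr (- \<alpha>) * \<bar>x \<bullet> e\<bar> * gaussian e (real m + 1) x)) \<longlonglongrightarrow> 0"
proof -
  let ?h = "\<lambda>(m::nat) x. norm x powr (- \<alpha>) * (sqrt (real m + 2) * \<bar>x \<bullet> e\<bar> * gaussian e (real m + 1) x)"
  have "(\<lambda>m. LINT x|lborel. ?h m x) \<longlonglongrightarrow> (LINT x::'a|lborel. (0::real))"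
  proof (rule integral_dominated_convergence)
    show "integrable lborel (\<lambda>x::'a. 2 * (norm x powr (- \<alpha>) * exp (- (1/2 * (norm x)\<^sup>2))))"
      by (intro integrable_mult_right integrable_norm_powr_gaussian assms) simp
    show "AE x in lborel. (\<lambda>m. ?h m x) \<longlonglongrightarrow> 0"
    proof (rule AE_I2)
      fix x :: 'a
      have *: "(\<lambda>m. sqrt (real m + 2) * t * exp (- (w + (real m + 1) * t\<^sup>2) / 2)) \<longlonglongrightarrow> 0"
        if "t > 0" for t w :: real
        using that by real_asymp
      \<comment> \<open>Off the hyperplane \<open>x . e = 0\<close> the exponential beats the square
        root; on it the factor \<open>|x . e|\<close> vanishes.\<close>
      have "(\<lambda>m. sqrt (real m + 2) * \<bar>x \<bullet> e\<bar> * gaussian e (real m + 1) x) \<longlonglongrightarrow> 0"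
        unfolding gaussian_def
        using *[of "\<bar>x \<bullet> e\<bar>" "(norm x)\<^sup>2"] by (cases "x \<bullet> e = 0") simp_all
      then show "(\<lambda>m. ?h m x) \<longlonglongrightarrow> 0"
        by (rule tendsto_mult_right_zero)
    qed
    show "AE x in lborel. norm (?h m x) \<le> 2 * (norm x powr (- \<alpha>) * exp (- (1/2 * (norm x)\<^sup>2)))" for m
    proof (rule AE_I2)
      fix x :: 'a
      let ?u = "sqrt (real m + 2) * \<bar>x \<bullet> e\<bar>"
      have u: "?u\<^sup>2 = (real m + 2) * (x \<bullet> e)\<^sup>2"
        by (simp add: power_mult_distrib)
      \<comment> \<open>Comparing exponents requires (m + 2) / 4 <= (m + 1) / 2, which holds for all
        m >= 0. The resulting bound does not depend on \<open>m\<close>.\<close>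
      have "?u * gaussian e (real m + 1) x \<le> ?u * (exp (- (?u\<^sup>2 / 4)) * exp (- (1/2 * (norm x)\<^sup>2)))"
        unfolding gaussian_def mult_exp_exp u
        by (intro mult_left_mono) (auto simp: field_simps)
      also have "\<dots> \<le> 2 * exp (- (1/2 * (norm x)\<^sup>2))"
        unfolding mult.assoc[symmetric] by (intro mult_right_mono mult_exp_neg_square_le_2) simp
      finally have "norm x powr (- \<alpha>) * (?u * gaussian e (real m + 1) x) \<le>
          norm x powr (- \<alpha>) * (2 * exp (- (1/2 * (norm x)\<^sup>2)))"
        by (rule mult_left_mono) simp
      then show "norm (?h m x) \<le> 2 * (norm x powr (- \<alpha>) * exp (- (1/2 * (norm x)\<^sup>2)))"
        using gaussian_pos[of e "real m + 1" x] by (simp add: abs_mult mult_ac)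
    qed
  qed measurable
  moreover have "?h m x = sqrt (real m + 2) * (norm x powr (- \<alpha>) * \<bar>x \<bullet> e\<bar> * gaussian e (real m + 1) x)"
    for m x
    by simp
  ultimately show ?thesis
    by (simp only: integral_mult_right_zero integral_zero)
qed

text \<open>The integrand is nonnegative and vanishes only on the null hyperplane
  \<open>x . e = 0\<close>, so its integral cannot be 0.\<close>

lemma weighted_gaussian_integral_pos:
  fixes e :: "'a::euclidean_space" and \<alpha> :: real
  assumes "0 \<le> \<alpha>" "\<alpha> < DIM('a)" "e \<in> Basis" "s \<ge> 0"
  shows "0 < (LINT x|lborel. norm x powr (- \<alpha>) * \<bar>x \<bullet> e\<bar> * gaussian e s x)"
proof -
  let ?f = "\<lambda>x. norm x powr (- \<alpha>) * \<bar>x \<bullet> e\<bar> * gaussian e s x"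
  have nonneg: "0 \<le> ?f x" for x
    using gaussian_pos[of e s x] by simp
  have int: "integrable lborel ?f"
    by (rule integrable_norm_powr_times_gaussian) (use assms Basis_le_norm in auto)
  have "(LINT x|lborel. ?f x) \<noteq> 0"
  proof
    assume "(LINT x|lborel. ?f x) = 0"
    then have "AE x in lborel. ?f x = 0"
      using integral_nonneg_eq_0_iff_AE[OF int] nonneg by simp
    with AE_lborel_inner_nonzero[OF assms(3)] have "AE x::'a in lborel. False"
    proof eventually_elim
      case (elim x)
      then show ?case
        using gaussian_pos[of e s x] by auto
    qed
    then show False
      by (simp add: AE_iff_measurable[OF _ refl])
  qed
  moreover have "0 \<le> (LINT x|lborel. ?f x)"
    using nonneg by simp
  ultimately show ?thesis by simp
qed

section \<open>The convex body\<close>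

locale coordinate_norm =
  fixes e :: "'a::euclidean_space" and \<epsilon> :: real
  assumes pos: "\<epsilon> > 0"
begin

definition N :: "'a \<Rightarrow> real" where
  "N x = \<bar>x \<bullet> e\<bar> + \<epsilon> * norm x"

lemma continuous_on_N [continuous_intros]: "continuous_on S N"
  unfolding N_def[abs_def] by (intro continuous_intros)

lemma N_scaleR: "N (c *\<^sub>R x) = \<bar>c\<bar> * N x"
  by (simp add: N_def abs_mult algebra_simps)

lemma N_pos: "x \<noteq> 0 \<Longrightarrow> N x > 0"
  using pos by (simp add: N_def add_nonneg_pos)

lemma N_triangle: "N (x + y) \<le> N x + N y"
proof -
  have "\<epsilon> * norm (x + y) \<le> \<epsilon> * (norm x + norm y)"
    using pos norm_triangle_ineq by (intro mult_left_mono) auto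
  then show ?thesis
    unfolding N_def by (simp add: inner_add_left algebra_simps)
qed

lemma convex_body: "convex_body {x. N x \<le> 1}"
  unfolding convex_body_def
proof (intro conjI)
  have "norm x \<le> 1 / \<epsilon>" if "N x \<le> 1" for x
  proof -
    have "\<epsilon> * norm x \<le> 1"
      using that abs_ge_zero[of "x \<bullet> e"] unfolding N_def by linarith
    then show ?thesis
      using pos by (simp add: field_simps)
  qed
  then have "bounded {x. N x \<le> 1}"
    unfolding bounded_iff by auto
  moreover have "closed {x. N x \<le> 1}"
    by (intro closed_Collect_le continuous_intros)
  ultimately show "compact {x. N x \<le> 1}"
    by (simp add: compact_eq_bounded_closed)
  show "convex {x. N x \<le> 1}"
  proof (rule convexI)
    fix x y and u v :: real
    assume xy: "x \<in> {x. N x \<le> 1}" "y \<in> {x. N x \<le> 1}" and uv: "0 \<le> u" "0 \<le> v" "u + v = 1"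
    have "N (u *\<^sub>R x + v *\<^sub>R y) \<le> u * N x + v * N y"
      using N_triangle[of "u *\<^sub>R x" "v *\<^sub>R y"] uv by (simp add: N_scaleR)
    also have "\<dots> \<le> 1"
      using xy uv by (intro convex_bound_le) auto
    finally show "u *\<^sub>R x + v *\<^sub>R y \<in> {x. N x \<le> 1}"
      by simp
  qed
  have "open {x. N x < 1}"
    by (intro open_Collect_less continuous_intros)
  then have "{x. N x < 1} \<subseteq> interior {x. N x \<le> 1}"
    by (intro interior_maximal) auto
  moreover have "0 \<in> {x. N x < 1}"
    by (simp add: N_def)
  ultimately show "interior {x. N x \<le> 1} \<noteq> {}"
    by blast
qed

lemma origin_symmetric: "origin_symmetric {x. N x \<le> 1}"
proof -
  have "N (- x) = N x" for x
    by (simp add: N_def)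
  then show ?thesis
    unfolding origin_symmetric_def by (auto simp: image_iff) (metis minus_minus)
qed

text \<open>\<open>LEAST\<close> over the reals needs an attained minimum. For nonzero
  \<open>x\<close> it is attained by rescaling \<open>x\<close> to the boundary of the ball, for
  \<open>x = 0\<close> by \<open>a = 0\<close>; homogeneity shows that no smaller factor
  works.\<close>

lemma minkowski_functional: "minkowski_functional {x. N x \<le> 1} x = N x"
  unfolding minkowski_functional_def
proof (rule Least_equality)
  have "x = N x *\<^sub>R (inverse (N x) *\<^sub>R x)" "N (inverse (N x) *\<^sub>R x) \<le> 1" if "x \<noteq> 0"
    using N_pos[OF that] by (auto simp: N_scaleR)
  then have "x \<in> (\<lambda>y. N x *\<^sub>R y) ` {x. N x \<le> 1}" if "x \<noteq> 0"
    using that by blast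
  moreover have "N 0 = 0"
    by (simp add: N_def)
  ultimately show "0 \<le> N x \<and> x \<in> (\<lambda>y. N x *\<^sub>R y) ` {x. N x \<le> 1}"
    using N_pos[of x] by (cases "x = 0") (auto intro!: image_eqI[of _ _ 0])
next
  fix a
  assume "0 \<le> a \<and> x \<in> (\<lambda>y. a *\<^sub>R y) ` {x. N x \<le> 1}"
  then show "N x \<le> a"
    by (auto simp: N_scaleR mult_left_le)
qed

end

section \<open>A nonnegative test function with a negative pairing\<close>

theorem lemma3p2:
  fixes \<alpha> :: real
  assumes "CARD('n::finite) \<ge> 3"
    and "real CARD('n) - 2 \<le> \<alpha>" and "\<alpha> < real CARD('n)"
    and "\<alpha> \<noteq> 1"
  shows "\<exists>L :: (real^'n) set. convex_body L \<and> origin_symmetric L \<and>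
    \<not> positive_definite_distribution
        (distribution_of (\<lambda>x. norm x powr (- \<alpha>) * minkowski_functional L x))"
proof -
  obtain e :: "real^'n" where e: "e \<in> Basis"
    using nonempty_Basis by blast
  have \<alpha>: "0 \<le> \<alpha>" "\<alpha> < DIM(real^'n)"
    using assms by auto
  define G where "G s = (LINT x|lborel. norm x powr (- \<alpha>) * \<bar>x \<bullet> e\<bar> * gaussian e s x)" for s
  define H where "H s = (LINT x|lborel. norm x powr (- \<alpha>) * norm x * gaussian e s x)" for s
  have G_int: "integrable lborel (\<lambda>x. norm x powr (- \<alpha>) * \<bar>x \<bullet> e\<bar> * gaussian e s x)"
    and H_int: "integrable lborel (\<lambda>x. norm x powr (- \<alpha>) * norm x * gaussian e s x)" if "s \<ge> 0" for s
    using \<alpha> that Basis_le_norm[OF e]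
    by - (rule integrable_norm_powr_times_gaussian; simp)+
  have "G 0 > 0"
    unfolding G_def by (intro weighted_gaussian_integral_pos \<alpha> e) simp
  then have "\<forall>\<^sub>F m in sequentially. sqrt (real m + 2) * G (real m + 1) < G 0"
    unfolding G_def by (intro order_tendstoD(2)[OF weighted_gaussian_integral_tendsto_0] \<alpha>)
  then obtain m where m: "sqrt (real m + 2) * G (real m + 1) < G 0"
    by (auto simp: eventually_sequentially)
  define a where "a = real m + 2"
  have a: "a \<ge> 1" "sqrt a * G (a - 1) < G 0"
    using m by (auto simp: a_def add.commute)
  \<comment> \<open>\<open>h\<close> is the change in the contribution of the Euclidean part of the
    norm, whose sign is left open. Dividing the gap by \<open>|h| + 1\<close> makes
    \<open>\<epsilon> * h\<close> strictly smaller than the gap and avoids division by 0.\<close>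
  define h where "h = sqrt a * H (a - 1) - H 0"
  define \<epsilon> where "\<epsilon> = (G 0 - sqrt a * G (a - 1)) / (\<bar>h\<bar> + 1)"
  have \<epsilon>: "\<epsilon> > 0" "\<epsilon> * h < G 0 - sqrt a * G (a - 1)"
  proof -
    show "\<epsilon> > 0"
      using a by (simp add: \<epsilon>_def)
    then have "\<epsilon> * h < \<epsilon> * (\<bar>h\<bar> + 1)"
      by (intro mult_strict_left_mono) auto
    then show "\<epsilon> * h < G 0 - sqrt a * G (a - 1)"
      by (simp add: \<epsilon>_def)
  qed
  interpret coordinate_norm e \<epsilon>
    by standard (rule \<epsilon>)
  let ?L = "{x. N x \<le> 1}"
  let ?T = "distribution_of (\<lambda>x. norm x powr (- \<alpha>) * minkowski_functional ?L x)"
  \<comment> \<open>Both Gaussians have value 1 at the origin, and the one with variance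
    \<open>a >= 1\<close> is pointwise the larger. Writing \<open>1 / 1 - 1\<close> for 0 lets
    \<open>fourier_transform_gaussian\<close> apply to the second one with
    \<open>a = 1\<close>.\<close>
  define \<phi> where "\<phi> x = complex_of_real (gaussian e (1 / a - 1) x) - complex_of_real (gaussian e (1 / 1 - 1) x)"
    for x
  define \<kappa> where "\<kappa> = sqrt (2 * pi) ^ DIM(real^'n)"
  have "\<kappa> > 0"
    by (simp add: \<kappa>_def)
  have schwartz: "schwartz_function \<phi>"
    unfolding \<phi>_def[abs_def] using a e
    by (intro schwartz_function_diff schwartz_function_gaussian) auto
  have nonneg: "\<phi> x \<in> \<real>\<^sub>\<ge>\<^sub>0" for x
    using gaussian_antimono[of "1 / a - 1" "1 / 1 - 1" e x] a
    by (auto simp: \<phi>_def complex_nonneg_Reals_iff)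
  have FT: "fourier_transform \<phi> \<xi> =
      complex_of_real (\<kappa> * (sqrt a * gaussian e (a - 1) \<xi> - gaussian e 0 \<xi>))" for \<xi>
  proof -
    have "fourier_transform \<phi> \<xi> = fourier_transform (\<lambda>x. complex_of_real (gaussian e (1 / a - 1) x)) \<xi> -
        fourier_transform (\<lambda>x. complex_of_real (gaussian e (1 / 1 - 1) x)) \<xi>"
      unfolding fourier_transform_def \<phi>_def left_diff_distrib
      using a by (intro Bochner_Integration.integral_diff integrable_fourier_gaussian e) auto
    then show ?thesis
      using a e by (simp only: fourier_transform_gaussian) (simp add: \<kappa>_def algebra_simps)
  qed
  have "distribution_fourier ?T \<phi> =
      (LINT x|lborel. complex_of_real (norm x powr (- \<alpha>) * N x *
        (\<kappa> * (sqrt a * gaussian e (a - 1) x - gaussian e 0 x))))"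
    by (simp add: distribution_fourier_def distribution_of_def FT minkowski_functional)
  also have "\<dots> = complex_of_real (LINT x|lborel. norm x powr (- \<alpha>) * N x *
        (\<kappa> * (sqrt a * gaussian e (a - 1) x - gaussian e 0 x)))"
    by (rule integral_complex_of_real)
  \<comment> \<open>The two summands of \<open>N\<close> and the two Gaussians give four separately
    integrable terms, matching \<open>G\<close> and \<open>H\<close> at \<open>a - 1\<close> and at
    0.\<close>
  also have "(LINT x|lborel. norm x powr (- \<alpha>) * N x *
        (\<kappa> * (sqrt a * gaussian e (a - 1) x - gaussian e 0 x))) =
      (LINT x|lborel. \<kappa> * (sqrt a * (norm x powr (- \<alpha>) * \<bar>x \<bullet> e\<bar> * gaussian e (a - 1) x) +
        \<epsilon> * (sqrt a * (norm x powr (- \<alpha>) * norm x * gaussian e (a - 1) x)) -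
        norm x powr (- \<alpha>) * \<bar>x \<bullet> e\<bar> * gaussian e 0 x -
        \<epsilon> * (norm x powr (- \<alpha>) * norm x * gaussian e 0 x)))"
    by (intro Bochner_Integration.integral_cong) (auto simp: N_def algebra_simps)
  also have "\<dots> = \<kappa> * (sqrt a * G (a - 1) + \<epsilon> * (sqrt a * H (a - 1)) - G 0 - \<epsilon> * H 0)"
    using a by (simp add: G_int H_int G_def H_def)
  also have "\<dots> = \<kappa> * (sqrt a * G (a - 1) + \<epsilon> * h - G 0)"
    by (simp add: h_def algebra_simps)
  finally have "distribution_fourier ?T \<phi> = complex_of_real (\<kappa> * (sqrt a * G (a - 1) + \<epsilon> * h - G 0))" .
  moreover have "\<kappa> * (sqrt a * G (a - 1) + \<epsilon> * h - G 0) < 0"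
    using \<open>\<kappa> > 0\<close> \<epsilon> by (simp add: mult_less_0_iff)
  ultimately have "distribution_fourier ?T \<phi> \<notin> \<real>\<^sub>\<ge>\<^sub>0"
    by (simp add: complex_nonneg_Reals_iff del: of_real_mult of_real_add of_real_diff)
  then have "\<not> positive_definite_distribution ?T"
    unfolding positive_definite_distribution_def positive_distribution_def
    using schwartz nonneg by blast
  then show ?thesis
    using convex_body origin_symmetric by blast
qed

end
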